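(* Let $(a,b,c)$ be a Markov triple with $0<a<b$, $0<c<b$, $6\leq b$. Then there exists a unique reduced polynomial solution $(f_1^*,f_2,f_3^* )\in \Gamma_M I$ representing $(a,b,c)$, i.e. such that $\mathrm{Ev}(f_1^*,f_2,f_3^* )=(a,b,c)$.
   Context: A Markov triple is a triple $(a,b,c)$ of positive integers with $a^2+b^2+c^2-abc=0$. Let $A=\mathbb Z[s_1,s_2,s_3^{\pm1}]$ with the ring involution $f^*(s_1,s_2,s_3)=f\left(\frac{s_2}{s_3},\frac{s_1}{s_3},\frac1{s_3}\right)$. (If $s_i$ is the $i$-th elementary symmetric function of $z_1,z_2,z_3$, then $A$ is the ring of symmetric Laurent polynomials in $z_1,z_2,z_3$ with integer coefficients, and $*$ is $z_i\mapsto 1/z_i$.) The $*$-Markov equation for $(a,b,c)\in A^3$ is $aa^*+bb^*+cc^*-abc=\frac{3s_1s_2-s_1^3}{s_3}$. Its initial solution is $I=(s_1,\frac{s_1}{s_3},s_1)$. The evaluation map $\mathrm{Ev}:A^3\to\mathbb Z^3$ evaluates each coordinate at $s_1=3,s_2=3,s_3=1$. The $*$-Markov group $\Gamma_M$ is the group of transformations of $A^3$ generated by: $\lambda_{i,j}:(a,b,c)\mapsto((-1)^ia,(-1)^{i+j}b,(-1)^jc)$, $i,j\in\mathbb Z/2$; $\sigma_1:(a,b,c)\mapsto(b,a,c)$ and $\sigma_2:(a,b,c)\mapsto(a,c,b)$; $\tau_1:(a,b,c)\mapsto(-a^*,c^*,b^*-ac)$ and $\tau_2:(a,b,c)\mapsto(b^*,a^*-bc,-c^*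 )$; $\mu_{i,j}:(a,b,c)\mapsto(s_3^ia,s_3^{-i-j}b,s_3^jc)$, $i,j\in\mathbb Z$. It preserves the set of solutions of the $*$-Markov equation. $\Gamma_MI$ is the orbit of $I$. A solution of the $*$-Markov equation written in the form $(f_1^*,f_2,f_3^* )$ is a reduced polynomial solution if each of $f_1,f_2,f_3$ is a nonconstant polynomial in $s_1,s_2,s_3$ not divisible by $s_3$. *)

theory Defs
  imports
    "HOL-Library.Poly_Mapping"
    "HOL-Library.Product_Plus"
    "HOL-Algebra.Bij"
    "HOL-Algebra.Generated_Groups"
begin

definition markov_triple :: "int \<Rightarrow> int \<Rightarrow> int \<Rightarrow> bool" where
  "markov_triple a b c \<longleftrightarrow>
     0 < a \<and> 0 < b \<and> 0 < c \<and> a\<^sup>2 + b\<^sup>2 + c\<^sup>2 - a * b * c = 0"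

text \<open>
  The ring of polynomials in \<open>s\<^sub>1, s\<^sub>2\<close> and Laurent polynomials in \<open>s\<^sub>3\<close> over the integers,
  as the monoid ring of exponent vectors: the key \<open>(i, j, k)\<close> stands for the monomial
  \<open>s\<^sub>1\<close>-to-the-\<open>i\<close> times \<open>s\<^sub>2\<close>-to-the-\<open>j\<close> times \<open>s\<^sub>3\<close>-to-the-\<open>k\<close>, where only \<open>k\<close> may be negative.
  Multiplication of \<open>\<Rightarrow>\<^sub>0\<close> is convolution.
\<close>

type_synonym laurent = "(nat \<times> nat \<times> int) \<Rightarrow>\<^sub>0 int"
type_synonym laurent3 = "laurent \<times> laurent \<times> laurent"

definition s1 :: laurent where "s1 = Poly_Mapping.single (1, 0, 0) 1"
definition s2 :: laurent where "s2 = Poly_Mapping.single (0, 1, 0) 1"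
definition s3 :: laurent where "s3 = Poly_Mapping.single (0, 0, 1) 1"
definition s3inv :: laurent where "s3inv = Poly_Mapping.single (0, 0, -1) 1"

text \<open>Integer powers of a unit \<open>z\<close> of a commutative ring with given inverse \<open>w\<close>
  (\<open>powi\<close> needs a division ring).\<close>

definition unit_pow :: "'a::comm_ring_1 \<Rightarrow> 'a \<Rightarrow> int \<Rightarrow> 'a" where
  "unit_pow z w k = (if 0 \<le> k then z ^ nat k else w ^ nat (- k))"

text \<open>Substitution \<open>s\<^sub>1 := x\<close>, \<open>s\<^sub>2 := y\<close>, \<open>s\<^sub>3 := z\<close>, where \<open>w\<close> is the inverse of the unit \<open>z\<close>.\<close>

definition laurent_subst ::
  "'a::comm_ring_1 \<Rightarrow> 'a \<Rightarrow> 'a \<Rightarrow> 'a \<Rightarrow> laurent \<Rightarrow> 'a" where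
  "laurent_subst x y z w f =
     (\<Sum>(i, j, k) \<in> Poly_Mapping.keys f.
        of_int (Poly_Mapping.lookup f (i, j, k)) * x ^ i * y ^ j * unit_pow z w k)"

definition star :: "laurent \<Rightarrow> laurent" where
  "star = laurent_subst (s2 * s3inv) (s1 * s3inv) s3inv s3"

definition star_markov_solution :: "laurent3 \<Rightarrow> bool" where
  "star_markov_solution = (\<lambda>(a, b, c).
     a * star a + b * star b + c * star c - a * b * c = (3 * s1 * s2 - s1 ^ 3) * s3inv)"

definition initial_solution :: laurent3 where
  "initial_solution = (s1, s1 * s3inv, s1)"

definition Ev :: "laurent3 \<Rightarrow> int \<times> int \<times> int" where
  "Ev = (\<lambda>(a, b, c).
     (laurent_subst 3 3 1 1 a, laurent_subst 3 3 1 1 b, laurent_subst 3 3 1 1 c))"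

text \<open>In \<open>lambda_tr\<close> the indices live in the integers modulo 2, represented by arbitrary
  natural numbers since only their parity matters.\<close>

definition lambda_tr :: "nat \<Rightarrow> nat \<Rightarrow> laurent3 \<Rightarrow> laurent3" where
  "lambda_tr i j = (\<lambda>(a, b, c). ((-1) ^ i * a, (-1) ^ (i + j) * b, (-1) ^ j * c))"

definition sigma1 :: "laurent3 \<Rightarrow> laurent3" where
  "sigma1 = (\<lambda>(a, b, c). (b, a, c))"

definition sigma2 :: "laurent3 \<Rightarrow> laurent3" where
  "sigma2 = (\<lambda>(a, b, c). (a, c, b))"

definition tau1 :: "laurent3 \<Rightarrow> laurent3" where
  "tau1 = (\<lambda>(a, b, c). (- star a, star c, star b - a * c))"

definition tau2 :: "laurent3 \<Rightarrow> laurent3" where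
  "tau2 = (\<lambda>(a, b, c). (star b, star a - b * c, - star c))"

definition mu_tr :: "int \<Rightarrow> int \<Rightarrow> laurent3 \<Rightarrow> laurent3" where
  "mu_tr i j = (\<lambda>(a, b, c).
     (unit_pow s3 s3inv i * a, unit_pow s3 s3inv (- i - j) * b, unit_pow s3 s3inv j * c))"

definition star_markov_generators :: "(laurent3 \<Rightarrow> laurent3) set" where
  "star_markov_generators =
     {lambda_tr i j | i j. True} \<union> {sigma1, sigma2} \<union> {tau1, tau2} \<union> {mu_tr i j | i j. True}"

definition star_markov_group :: "(laurent3 \<Rightarrow> laurent3) set" where
  "star_markov_group = generate (BijGroup UNIV) star_markov_generators"

definition star_markov_orbit :: "laurent3 set" where
  "star_markov_orbit = {g initial_solution | g. g \<in> star_markov_group}"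

text \<open>The subring of polynomials in \<open>s\<^sub>1, s\<^sub>2, s\<^sub>3\<close>. As \<open>s\<^sub>3\<close> is a unit of the Laurent ring,
  divisibility by \<open>s\<^sub>3\<close> must be taken in this subring.\<close>

definition is_polynomial :: "laurent \<Rightarrow> bool" where
  "is_polynomial f \<longleftrightarrow> (\<forall>(i, j, k) \<in> Poly_Mapping.keys f. 0 \<le> k)"

definition divisible_by_s3 :: "laurent \<Rightarrow> bool" where
  "divisible_by_s3 f \<longleftrightarrow> (\<exists>g. is_polynomial g \<and> f = s3 * g)"

definition reduced_polynomial :: "laurent \<Rightarrow> bool" where
  "reduced_polynomial f \<longleftrightarrow>
     is_polynomial f \<and> f \<notin> range of_int \<and> \<not> divisible_by_s3 f"

definition reduced_polynomial_solution :: "laurent3 \<Rightarrow> bool" where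
  "reduced_polynomial_solution x \<longleftrightarrow>
     star_markov_solution x \<and>
     (\<exists>f1 f2 f3. x = (star f1, f2, star f3) \<and>
        reduced_polynomial f1 \<and> reduced_polynomial f2 \<and> reduced_polynomial f3)"

end

theory Submission
  imports Defs "HOL-Computational_Algebra.Formal_Laurent_Series"
begin

text \<open>
  Up to signs and permutations the generators \<open>\<tau>\<^sub>1, \<tau>\<^sub>2\<close> act as Vieta involutions
  \<open>(f, g, h) \<mapsto> (f\<^sup>*, f h - g\<^sup>*, h\<^sup>*)\<close>, lifting the classical involutions
  \<open>(a, b, c) \<mapsto> (a, a c - b, c)\<close> of Markov triples. An entry of a Markov triple is the strict maximum
  either before or after the involution in its position (\<open>vieta_root_cases\<close>), and \<open>(3, 3, 3)\<close> is the
  only triple without a strict maximum (\<open>markov_triple_no_max\<close>). Hence every triple is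
  reached from \<open>(3, 3, 3)\<close> by exactly one sequence of moves each of which creates a new strict maximum.
  All permutations of the initial solution differ from it by \<open>\<mu>\<close> moves, and these are normalized by the
  Vieta involutions. Therefore every triple lifts to the orbit uniquely up to \<open>\<mu>\<close>
  (\<open>markov_tree_exists\<close>, \<open>markov_tree_unique\<close>), once the signs are fixed by positivity
  (\<open>star_markov_orbit_positive\<close>).

  It remains to see that each class of lifts modulo \<open>\<mu>\<close> contains exactly one reduced solution. Let
  \<open>d\<close> be the order of vanishing along \<open>s\<^sub>3 = 0\<close>; it is a valuation, because the ring embeds into
  Laurent series in \<open>s\<^sub>3\<close> over a polynomial ring. A reduced polynomial has \<open>d = 0\<close>, so the two free
  exponents of a \<open>\<mu>\<close> move are determined by the outer entries; this is uniqueness. They also determine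
  the exponent for the middle entry, so existence needs the relation
  \<open>d (f h - g\<^sup>*) = d f + d h\<close> for the last move: the product must not be disturbed in its lowest term.
  The reason is that \<open>d u + d (u\<^sup>*)\<close> is negative for all entries. If \<open>f\<close> was the entry created last,
  say from \<open>u\<close> with partners \<open>v\<close> and \<open>w\<close>, so that \<open>g = v\<^sup>*\<close> and \<open>h = w\<^sup>*\<close>, then by
  induction \<open>d f = d v + d w\<close>, hence
  \<open>d f + d h = d v + d w + d (w\<^sup>*) < d v = d (g\<^sup>*)\<close>. The same estimate for the starred entries
  shows that \<open>d u + d (u\<^sup>*)\<close> is additive and stays negative (\<open>vieta_order_step\<close>,
  \<open>markov_tree_orders\<close>). Negativity also guarantees that the resulting polynomials are not constant.
\<close>

section \<open>Substitution into Laurent polynomials\<close>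

lemma poly_mapping_sum_single:
  fixes f :: "'a \<Rightarrow>\<^sub>0 'b::comm_monoid_add"
  shows "(\<Sum>m\<in>Poly_Mapping.keys f. Poly_Mapping.single m (Poly_Mapping.lookup f m)) = f"
proof (rule poly_mapping_eqI)
  fix n
  have "(\<Sum>m\<in>Poly_Mapping.keys f. Poly_Mapping.lookup (Poly_Mapping.single m (Poly_Mapping.lookup f m)) n)
      = (\<Sum>m\<in>Poly_Mapping.keys f. if m = n then Poly_Mapping.lookup f m else 0)"
    by (intro sum.cong) (auto simp: lookup_single when_def)
  then show "Poly_Mapping.lookup (\<Sum>m\<in>Poly_Mapping.keys f. Poly_Mapping.single m (Poly_Mapping.lookup f m)) n
      = Poly_Mapping.lookup f n"
    by (simp add: lookup_sum in_keys_iff)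
qed

text \<open>The one computation behind multiplicativity of substitution: it mixes nonnegative and negative
  exponents, which \<open>unit_pow\<close> treats by powers of two different elements.\<close>

lemma unit_pow_add:
  assumes "z * w = (1 :: 'a::comm_ring_1)"
  shows "unit_pow z w (k + l) = unit_pow z w k * unit_pow z w l"
proof -
  have cancel: "z ^ n * w ^ n = 1" for n
    using assms by (simp flip: power_mult_distrib)
  have left: "z ^ (n + d) * w ^ n = z ^ d" for n d
    using cancel[of n] by (simp add: power_add mult.assoc mult.left_commute)
  have right: "z ^ n * w ^ (n + d) = w ^ d" for n d
    using cancel[of n] by (simp add: power_add flip: mult.assoc)
  consider "0 \<le> k" "0 \<le> l" | "k < 0" "l < 0" | "0 \<le> k" "l < 0" | "k < 0" "0 \<le> l" by linarith
  then show ?thesis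
  proof cases
    case 1
    then show ?thesis by (simp add: unit_pow_def nat_add_distrib power_add)
  next
    case 2
    then have "nat (- (k + l)) = nat (- k) + nat (- l)" by linarith
    with 2 show ?thesis by (simp add: unit_pow_def power_add)
  next
    case 3
    show ?thesis
    proof (cases "0 \<le> k + l")
      case True
      with 3 show ?thesis
        using left[of "nat (- l)" "nat (k + l)"] by (simp add: unit_pow_def flip: nat_add_distrib)
    next
      case False
      with 3 show ?thesis
        using right[of "nat k" "nat (- (k + l))"] by (simp add: unit_pow_def flip: nat_add_distrib)
    qed
  next
    case 4
    show ?thesis
    proof (cases "0 \<le> k + l")
      case True
      with 4 show ?thesis
        using left[of "nat (- k)" "nat (k + l)"]
        by (simp add: unit_pow_def mult.commute flip: nat_add_distrib)
    next
      case False
      with 4 show ?thesis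
        using right[of "nat l" "nat (- (k + l))"]
        by (simp add: unit_pow_def mult.commute flip: nat_add_distrib)
    qed
  qed
qed

text \<open>The keys of a sum or product are not determined by the keys of its parts, as coefficients may
  cancel. Summing over a larger set of exponents makes both sides comparable.\<close>

lemma laurent_subst_superset:
  assumes "finite K" "Poly_Mapping.keys f \<subseteq> K"
  shows "laurent_subst x y z w f =
    (\<Sum>(i, j, k) \<in> K. of_int (Poly_Mapping.lookup f (i, j, k)) * x ^ i * y ^ j * unit_pow z w k)"
  unfolding laurent_subst_def
  by (rule sum.mono_neutral_left) (use assms in \<open>auto simp: in_keys_iff\<close>)

lemma laurent_subst_single:
  "laurent_subst x y z w (Poly_Mapping.single (i, j, k) c) = of_int c * x ^ i * y ^ j * unit_pow z w k"
  by (subst laurent_subst_superset[where K = "{(i, j, k)}"]) auto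

lemma laurent_subst_0 [simp]: "laurent_subst x y z w 0 = 0"
  by (simp add: laurent_subst_def)

lemma laurent_subst_add:
  "laurent_subst x y z w (f + g) = laurent_subst x y z w f + laurent_subst x y z w g"
proof -
  let ?K = "Poly_Mapping.keys f \<union> Poly_Mapping.keys g"
  have "Poly_Mapping.keys (f + g) \<subseteq> ?K" by (rule keys_add)
  then show ?thesis
    by (simp add: laurent_subst_superset[where K = ?K] flip: sum.distrib)
       (auto simp: lookup_add algebra_simps intro!: sum.cong)
qed

lemma laurent_subst_uminus: "laurent_subst x y z w (- f) = - laurent_subst x y z w f"
  using laurent_subst_add[of x y z w f "- f"] by (simp add: add_eq_0_iff)

lemma laurent_subst_diff:
  "laurent_subst x y z w (f - g) = laurent_subst x y z w f - laurent_subst x y z w g"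
  using laurent_subst_add[of x y z w f "- g"] by (simp add: laurent_subst_uminus)

lemma laurent_subst_sum:
  "laurent_subst x y z w (\<Sum>a\<in>A. F a) = (\<Sum>a\<in>A. laurent_subst x y z w (F a))"
  by (induction A rule: infinite_finite_induct) (auto simp: laurent_subst_add)

lemma laurent_subst_1 [simp]: "laurent_subst x y z w 1 = 1"
  using laurent_subst_single[of x y z w 0 0 0 1]
  by (simp add: unit_pow_def flip: zero_prod_def)

lemma laurent_subst_mult:
  assumes "z * w = 1"
  shows "laurent_subst x y z w (f * g) = laurent_subst x y z w f * laurent_subst x y z w g"
proof -
  let ?S = "laurent_subst x y z w"
  let ?t = "\<lambda>f m. Poly_Mapping.single m (Poly_Mapping.lookup f m)"
  have single: "?S (Poly_Mapping.single m c * Poly_Mapping.single n d)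
      = ?S (Poly_Mapping.single m c) * ?S (Poly_Mapping.single n d)" for m n c d
    by (cases m; cases n)
       (simp add: mult_single laurent_subst_single unit_pow_add[OF assms] power_add algebra_simps)
  have "?S (f * g) = ?S ((\<Sum>m\<in>Poly_Mapping.keys f. ?t f m) * (\<Sum>n\<in>Poly_Mapping.keys g. ?t g n))"
    by (simp only: poly_mapping_sum_single)
  also have "\<dots> = ?S (\<Sum>m\<in>Poly_Mapping.keys f. ?t f m) * ?S (\<Sum>n\<in>Poly_Mapping.keys g. ?t g n)"
    by (simp add: sum_product laurent_subst_sum single)
  finally show ?thesis by (simp only: poly_mapping_sum_single)
qed

lemma laurent_subst_power:
  assumes "z * w = 1"
  shows "laurent_subst x y z w (f ^ n) = laurent_subst x y z w f ^ n"
  by (induction n) (simp_all add: laurent_subst_mult[OF assms])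

lemma laurent_subst_unit_pow:
  assumes "z * w = 1"
  shows "laurent_subst x y z w (unit_pow f g k) = unit_pow (laurent_subst x y z w f) (laurent_subst x y z w g) k"
  by (simp add: unit_pow_def laurent_subst_power[OF assms])

lemma of_int_eq_single: "(of_int c :: laurent) = Poly_Mapping.single (0, 0, 0) c"
  using single_of_int[of c, where 'a = "nat \<times> nat \<times> int" and 'b = int] by (simp add: zero_prod_def)

lemma laurent_subst_of_int: "laurent_subst x y z w (of_int n) = of_int n"
  by (simp add: of_int_eq_single laurent_subst_single unit_pow_def)

lemma laurent_subst_s1: "laurent_subst x y z w s1 = x"
  and laurent_subst_s2: "laurent_subst x y z w s2 = y"
  and laurent_subst_s3: "laurent_subst x y z w s3 = z"
  and laurent_subst_s3inv: "laurent_subst x y z w s3inv = w"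
  by (simp_all add: s1_def s2_def s3_def s3inv_def laurent_subst_single unit_pow_def)

lemmas laurent_subst_gens = laurent_subst_s1 laurent_subst_s2 laurent_subst_s3 laurent_subst_s3inv

text \<open>Since \<open>star\<close>, evaluation and the embedding into Laurent series below are all substitutions,
  every identity between their composites reduces to the images of the generators.\<close>

lemma laurent_subst_compose:
  assumes "z' * w' = 1"
  shows "laurent_subst x' y' z' w' (laurent_subst x y z w f) =
    laurent_subst (laurent_subst x' y' z' w' x) (laurent_subst x' y' z' w' y)
      (laurent_subst x' y' z' w' z) (laurent_subst x' y' z' w' w) f"
  unfolding laurent_subst_def[of x y z w f] 
    laurent_subst_def[of "laurent_subst x' y' z' w' x" _ _ _ f]
  by (auto simp: laurent_subst_sum laurent_subst_mult laurent_subst_power laurent_subst_unit_pow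
      laurent_subst_of_int assms intro!: sum.cong)

lemma s3_s3inv: "s3 * s3inv = 1"
  by (simp add: s3_def s3inv_def mult_single flip: zero_prod_def)

lemma s3inv_s3: "s3inv * s3 = 1"
  by (simp add: s3_def s3inv_def mult_single flip: zero_prod_def)

lemma s1_power: "s1 ^ n = Poly_Mapping.single (n, 0, 0) 1"
  by (induction n) (simp_all add: s1_def mult_single flip: zero_prod_def)

lemma s2_power: "s2 ^ n = Poly_Mapping.single (0, n, 0) 1"
  by (induction n) (simp_all add: s2_def mult_single flip: zero_prod_def)

lemma s3_power: "s3 ^ n = Poly_Mapping.single (0, 0, int n) 1"
  by (induction n) (simp_all add: s3_def mult_single flip: zero_prod_def)

lemma s3inv_power: "s3inv ^ n = Poly_Mapping.single (0, 0, - int n) 1"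
  by (induction n) (simp_all add: s3inv_def mult_single flip: zero_prod_def)

lemma s3_unit_pow: "unit_pow s3 s3inv k = Poly_Mapping.single (0, 0, k) 1"
  by (simp add: unit_pow_def s3_power s3inv_power)

lemma laurent_subst_id: "laurent_subst s1 s2 s3 s3inv f = f"
proof -
  have "laurent_subst s1 s2 s3 s3inv f =
     (\<Sum>m\<in>Poly_Mapping.keys f. Poly_Mapping.single m (Poly_Mapping.lookup f m))"
    unfolding laurent_subst_def
    by (rule sum.cong)
       (auto simp: s1_power s2_power s3_unit_pow of_int_eq_single mult_single)
  then show ?thesis by (simp only: poly_mapping_sum_single)
qed

section \<open>The involution and the units\<close>

lemma star_0 [simp]: "star 0 = 0"
  and star_1 [simp]: "star 1 = 1"
  and star_uminus [simp]: "star (- f) = - star f"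
  and star_diff [simp]: "star (f - g) = star f - star g"
  and star_mult [simp]: "star (f * g) = star f * star g"
  and star_power [simp]: "star (f ^ n) = star f ^ n"
  and star_of_int: "star (of_int c) = of_int c"
  and star_s1: "star s1 = s2 * s3inv"
  and star_s3: "star s3 = s3inv"
  and star_s3inv: "star s3inv = s3"
  by (simp_all add: star_def laurent_subst_uminus laurent_subst_diff
      laurent_subst_mult laurent_subst_power laurent_subst_of_int laurent_subst_gens s3inv_s3)

lemma laurent_subst_star:
  assumes "z * w = 1"
  shows "laurent_subst x y z w (star f) = laurent_subst (y * w) (x * w) w z f"
  by (simp add: star_def laurent_subst_compose laurent_subst_mult laurent_subst_gens assms)

lemma star_star [simp]: "star (star f) = f"
proof -
  have "star (star f) = laurent_subst (s1 * s3inv * s3) (s2 * s3inv * s3) s3 s3inv f"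
    unfolding fun_cong[OF star_def, of "star f"]
    by (simp add: laurent_subst_star s3inv_s3)
  then show ?thesis by (simp add: mult.assoc s3inv_s3 laurent_subst_id)
qed

text \<open>The point \<open>(3, 3, 1)\<close>, where all \<open>z\<^sub>i\<close> equal 1, is fixed by \<open>z\<^sub>i \<mapsto> 1/z\<^sub>i\<close>.\<close>

lemma eval_star: "laurent_subst 3 3 1 1 (star f) = (laurent_subst 3 3 1 1 f :: int)"
  by (simp add: laurent_subst_star)

abbreviation s3_pow :: "int \<Rightarrow> laurent" where
  "s3_pow \<equiv> unit_pow s3 s3inv"

lemma s3_pow_0 [simp]: "s3_pow 0 = 1"
  by (simp add: unit_pow_def)

lemma s3_pow_1: "s3_pow 1 = s3"
  by (simp add: unit_pow_def)

lemma s3_pow_minus_1: "s3_pow (- 1) = s3inv"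
  by (simp add: unit_pow_def)

lemma s3_pow_mult: "s3_pow k * s3_pow l = s3_pow (k + l)"
  by (simp add: unit_pow_add s3_s3inv)

lemma s3_pow_mult': "s3_pow k * (s3_pow l * f) = s3_pow (k + l) * f"
  by (simp add: s3_pow_mult flip: mult.assoc)

lemma s3_pow_mult_mult: "(s3_pow k * f) * (s3_pow l * g) = s3_pow (k + l) * (f * g)"
  by (simp add: mult_ac flip: s3_pow_mult)

lemma star_s3_pow [simp]: "star (s3_pow k) = s3_pow (- k)"
  by (auto simp: unit_pow_def star_s3 star_s3inv)

lemma eval_s3_pow: "laurent_subst x y 1 1 (s3_pow k) = 1"
  by (simp add: laurent_subst_unit_pow laurent_subst_gens) (simp add: unit_pow_def)

section \<open>Orders of vanishing along \<open>s\<^sub>3 = 0\<close>\<close>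

text \<open>Expanding in powers of \<open>s\<^sub>3\<close> embeds the ring into formal Laurent series over
  \<open>\<int>[s\<^sub>1][s\<^sub>2]\<close>, which form an integral domain. Hence the lowest exponent of \<open>s\<^sub>3\<close> in an
  element is additive under multiplication.\<close>

definition to_fls :: "laurent \<Rightarrow> int poly poly fls" where
  "to_fls = laurent_subst (fls_const [:[:0, 1:]:]) (fls_const [:0, 1:]) fls_X fls_X_inv"

lemma fls_X_mult_inv: "fls_X * fls_X_inv = (1 :: 'a::comm_ring_1 fls)"
  by (simp add: fls_X_inv_times_conv_shift mult.commute)

lemma to_fls_simps [simp]:
  "to_fls 0 = 0" "to_fls 1 = 1"
  "to_fls (f - g) = to_fls f - to_fls g" "to_fls (f * g) = to_fls f * to_fls g"
  "to_fls (of_int n) = of_int n"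
  by (simp_all add: to_fls_def laurent_subst_diff laurent_subst_mult fls_X_mult_inv laurent_subst_of_int)

lemma to_fls_s1: "to_fls s1 = fls_const [:[:0, 1:]:]"
  and to_fls_s2: "to_fls s2 = fls_const [:0, 1:]"
  by (simp_all add: to_fls_def laurent_subst_gens)

lemma coeff_to_fls:
  "coeff (coeff (fls_nth (to_fls f) k) j) i = Poly_Mapping.lookup f (i, j, k)"
proof -
  have x_pow: "[:[:0, 1:]:] ^ n = [:monom (1 :: int) n:]" for n
    by (induction n) (simp_all add: monom_altdef one_pCons)
  have y_pow: "[:0, 1:] ^ n = (monom 1 n :: int poly poly)" for n
    by (simp add: monom_altdef)
  have t_pow: "unit_pow fls_X fls_X_inv l = (fls_shift (- l) 1 :: int poly poly fls)" for l
    by (simp add: unit_pow_def fls_X_power_conv_shift_1 fls_X_inv_power_conv_shift_1)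
  (* the three substituted powers combine into one monomial of a Laurent series with one term *)
  have monomial: "of_int c * fls_const [:[:0, 1:]:] ^ i' * fls_const [:0, 1:] ^ j' * unit_pow fls_X fls_X_inv k'
      = fls_shift (- k') (fls_const (monom (monom c i') j'))" for c i' j' k'
    by (simp add: t_pow fls_of_int x_pow y_pow fls_shifted_times_simps smult_monom of_int_poly flip: fls_const_power)
  have "coeff (coeff (fls_nth (to_fls f) k) j) i = 
     (\<Sum>m\<in>Poly_Mapping.keys f. Poly_Mapping.lookup (Poly_Mapping.single m (Poly_Mapping.lookup f m)) (i, j, k))"
    unfolding to_fls_def laurent_subst_def fls_nth_sum coeff_sum
    by (rule sum.cong) (auto simp: monomial lookup_single when_def split: prod.split)
  also have "\<dots> = Poly_Mapping.lookup f (i, j, k)"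
    by (simp only: poly_mapping_sum_single flip: lookup_sum)
  finally show ?thesis .
qed

lemma to_fls_eq_0_iff [simp]: "to_fls f = 0 \<longleftrightarrow> f = 0"
proof
  assume "to_fls f = 0"
  then have "Poly_Mapping.lookup f m = 0" for m
    using coeff_to_fls[of f "snd (snd m)" "fst (snd m)" "fst m"] by simp
  then show "f = 0" by (intro poly_mapping_eqI) simp
qed simp

definition s3_order :: "laurent \<Rightarrow> int" where
  "s3_order f = fls_subdegree (to_fls f)"

lemma s3_order_mult: "f \<noteq> 0 \<Longrightarrow> g \<noteq> 0 \<Longrightarrow> s3_order (f * g) = s3_order f + s3_order g"
  by (simp add: s3_order_def)

lemma s3_order_diff: "f \<noteq> 0 \<Longrightarrow> s3_order f < s3_order g \<Longrightarrow> s3_order (f - g) = s3_order f"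
  by (simp add: s3_order_def fls_subdegree_diff_eq1)

lemma s3_order_of_int [simp]: "s3_order (of_int n) = 0"
  by (simp add: s3_order_def)

lemma s3_order_s3_pow [simp]: "s3_order (s3_pow k) = k"
  by (simp add: s3_order_def to_fls_def laurent_subst_unit_pow fls_X_mult_inv laurent_subst_gens)
     (simp add: unit_pow_def)

lemma laurent_no_zero_divisors: "f * g = 0 \<longleftrightarrow> f = 0 \<or> g = (0 :: laurent)"
  using to_fls_eq_0_iff[of "f * g"] by (simp del: to_fls_eq_0_iff) simp

lemma star_eq_0_iff [simp]: "star f = 0 \<longleftrightarrow> f = 0"
  by (metis star_0 star_star)

lemma s3_pow_nonzero [simp]: "s3_pow k \<noteq> 0"
  using s3_pow_mult[of k "- k"] by auto

lemma s3_order_s3_pow_mult: "f \<noteq> 0 \<Longrightarrow> s3_order (s3_pow k * f) = k + s3_order f"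
  by (simp add: s3_order_mult)

lemma is_polynomial_iff: "is_polynomial f \<longleftrightarrow> 0 \<le> s3_order f"
proof
  assume "is_polynomial f"
  then have "Poly_Mapping.lookup f (i, j, k) = 0" if "k < 0" for i j k
    using that by (fastforce simp: is_polynomial_def simp flip: not_in_keys_iff_lookup_eq_zero)
  then have "fls_nth (to_fls f) k = 0" if "k < 0" for k
    using that by (intro poly_eqI) (simp add: coeff_to_fls)
  then show "0 \<le> s3_order f"
    unfolding s3_order_def by (rule fls_subdegree_ge0I)
next
  assume "0 \<le> s3_order f"
  then have "Poly_Mapping.lookup f (i, j, k) = 0" if "k < 0" for i j k
    using that by (simp add: s3_order_def flip: coeff_to_fls)
  then show "is_polynomial f"
    unfolding is_polynomial_def in_keys_iff by force
qed

text \<open>The monomial with exponents \<open>(i, j, k)\<close> is sent by \<open>star\<close> to the one with exponents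
  \<open>(j, i, - (i + j + k))\<close>, so the width of a nonzero \<open>f\<close> is the maximum of \<open>i + j + k\<close> minus
  the minimum of \<open>k\<close> over its monomials. It is positive exactly when some monomial involves \<open>s\<^sub>1\<close>
  or \<open>s\<^sub>2\<close> or two different powers of \<open>s\<^sub>3\<close> occur.\<close>

definition s3_width :: "laurent \<Rightarrow> int" where
  "s3_width f = - (s3_order f + s3_order (star f))"

lemma s3_width_star: "s3_width (star f) = s3_width f"
  by (simp add: s3_width_def)

lemma s3_width_of_int: "s3_width (of_int n) = 0"
  by (simp add: s3_width_def star_of_int)

lemma s3_width_s3_pow_mult: "s3_width (s3_pow k * f) = s3_width f"
  by (cases "f = 0") (simp_all add: s3_width_def s3_order_s3_pow_mult)

lemma s3_width_pos_nonzero: "0 < s3_width f \<Longrightarrow> f \<noteq> 0"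
  using s3_width_of_int[of 0] by auto

text \<open>A positive width excludes the constants, and it does so stably under multiplication by powers of
  \<open>s\<^sub>3\<close>; the order then decides both polynomiality and divisibility by \<open>s\<^sub>3\<close>.\<close>

lemma reduced_polynomialI:
  assumes "s3_order f = 0" "0 < s3_width f"
  shows "reduced_polynomial f"
proof -
  have "\<not> divisible_by_s3 f"
  proof
    assume "divisible_by_s3 f"
    then obtain g where g: "0 \<le> s3_order g" "f = s3_pow 1 * g"
      by (auto simp: divisible_by_s3_def is_polynomial_iff s3_pow_1)
    moreover have "g \<noteq> 0"
      using g s3_width_pos_nonzero[OF assms(2)] by auto
    ultimately show False
      using assms(1) by (simp add: s3_order_s3_pow_mult)
  qed
  moreover have "f \<notin> range of_int"
    using assms(2) s3_width_of_int by force
  ultimately show ?thesis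
    using assms(1) by (simp add: reduced_polynomial_def is_polynomial_iff)
qed

lemma reduced_polynomial_normalized:
  assumes "0 < s3_width f"
  shows "reduced_polynomial (s3_pow (- s3_order f) * f)"
  using assms s3_width_pos_nonzero[OF assms]
  by (intro reduced_polynomialI) (simp_all add: s3_order_s3_pow_mult s3_width_s3_pow_mult)

lemma reduced_polynomialD:
  assumes "reduced_polynomial f"
  shows "f \<noteq> 0" "s3_order f = 0"
proof -
  show "f \<noteq> 0"
    using assms range_eqI[of 0 of_int 0] by (auto simp: reduced_polynomial_def)
  have "s3_order f \<le> 0"
  proof (rule ccontr)
    assume "\<not> s3_order f \<le> 0"
    then have "is_polynomial (s3_pow (- 1) * f)"
      using \<open>f \<noteq> 0\<close> by (simp add: is_polynomial_iff s3_order_s3_pow_mult)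
    moreover have "f = s3 * (s3_pow (- 1) * f)"
      using s3_pow_mult'[of 1 "- 1" f] by (simp add: s3_pow_1)
    ultimately show False
      using assms by (auto simp: reduced_polynomial_def divisible_by_s3_def)
  qed
  then show "s3_order f = 0"
    using assms by (simp add: reduced_polynomial_def is_polynomial_iff)
qed

text \<open>The reason for uniqueness: the order of a reduced polynomial is zero, so no other element of its
  class modulo powers of \<open>s\<^sub>3\<close> is reduced.\<close>

lemma reduced_polynomial_s3_pow_mult:
  assumes "reduced_polynomial f" "reduced_polynomial (s3_pow k * f)"
  shows "k = 0"
  using reduced_polynomialD[OF assms(1)] reduced_polynomialD[OF assms(2)]
  by (simp add: s3_order_s3_pow_mult)

section \<open>Markov triples\<close>

lemma markov_triple_swap12: "markov_triple a b c \<longleftrightarrow> markov_triple b a c"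
  and markov_triple_swap23: "markov_triple a b c \<longleftrightarrow> markov_triple a c b"
  by (auto simp: markov_triple_def algebra_simps)

text \<open>If an entry is 1 or 2, the equation becomes a vanishing sum of a square and positive terms.\<close>

lemma markov_triple_ge_3:
  assumes "markov_triple a b c"
  shows "3 \<le> a"
proof -
  have eq: "a\<^sup>2 + b\<^sup>2 + c\<^sup>2 = a * b * c" and pos: "0 < a" "0 < b" "0 < c"
    using assms by (auto simp: markov_triple_def)
  have "a \<noteq> 1"
  proof
    assume "a = 1"
    with eq have "(b - c)\<^sup>2 + b * c + 1 = 0" by (simp add: power2_eq_square algebra_simps)
    moreover have "0 < b * c" using pos by simp
    ultimately show False using zero_le_power2[of "b - c"] by linarith
  qed
  moreover have "a \<noteq> 2"
  proof
    assume "a = 2"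
    with eq have "(b - c)\<^sup>2 + 4 = 0" by (simp add: power2_eq_square algebra_simps)
    then show False using zero_le_power2[of "b - c"] by linarith
  qed
  ultimately show ?thesis using pos by linarith
qed

text \<open>As a quadratic polynomial in its middle entry, the Markov equation has roots \<open>b\<close> and
  \<open>a * c - b\<close>, with product \<open>a\<^sup>2 + c\<^sup>2\<close>.\<close>

lemma markov_triple_vieta:
  assumes "markov_triple a b c"
  shows "markov_triple a (a * c - b) c"
proof -
  have eq: "b * (a * c - b) = a\<^sup>2 + c\<^sup>2" and pos: "0 < a" "0 < b" "0 < c"
    using assms by (auto simp: markov_triple_def power2_eq_square algebra_simps)
  have "0 < b * (a * c - b)" unfolding eq using pos by (simp add: add_pos_pos)
  then have "0 < a * c - b" using pos by (simp add: zero_less_mult_iff)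
  then show ?thesis
    using assms by (simp add: markov_triple_def power2_eq_square algebra_simps)
qed

text \<open>The roots \<open>b\<close> and \<open>a * c - b\<close> lie on opposite sides of the maximum of \<open>a\<close> and \<open>c\<close>
  (weakly, for the smaller one): for \<open>a \<le> c\<close> the quadratic polynomial takes at \<open>c\<close> the value
  \<open>a\<^sup>2 - (a - 2) * c\<^sup>2 \<le> 0\<close>, and the sum \<open>a * c\<close> of the roots exceeds \<open>2 * c\<close>. So
  every Vieta move either creates or destroys a strict maximum at its position.\<close>

lemma vieta_root_cases:
  assumes "markov_triple a b c"
  shows "(a < b \<and> c < b) \<noteq> (a < a * c - b \<and> c < a * c - b)"
proof -
  have aux: "(c < b) \<noteq> (c < a * c - b)" if m: "markov_triple a b c" and "a \<le> c" for a b c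
  proof -
    have a: "3 \<le> a" using markov_triple_ge_3[OF m] .
    have c: "0 < c" using m by (simp add: markov_triple_def)
    have "(c - b) * (c - (a * c - b)) = a\<^sup>2 - (a - 2) * c\<^sup>2"
      using m by (simp add: markov_triple_def power2_eq_square algebra_simps)
    also have "\<dots> \<le> a\<^sup>2 - c\<^sup>2"
      using a mult_right_mono[of 1 "a - 2" "c\<^sup>2"] by simp
    also have "\<dots> \<le> 0"
      using a \<open>a \<le> c\<close> by (simp add: power_mono)
    finally have prod: "(c - b) * (c - (a * c - b)) \<le> 0" .
    have "2 * c < b + (a * c - b)"
      using a c mult_right_mono[of 3 a c] by simp
    with prod show ?thesis
      by (smt (verit) mult_pos_pos mult_neg_neg)
  qed
  show ?thesis
  proof (cases "a \<le> c")
    case True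
    with aux[OF assms True] show ?thesis by auto
  next
    case False
    have "markov_triple c b a" using assms by (simp add: markov_triple_def algebra_simps)
    from aux[OF this] False show ?thesis by (auto simp: mult.commute)
  qed
qed

text \<open>Without a strict maximum the two largest entries are equal, say to \<open>l\<close>, and the equation reads
  \<open>(n - 2) * l\<^sup>2 = n\<^sup>2\<close> with \<open>n \<le> l\<close>.\<close>

lemma markov_triple_no_max:
  assumes "markov_triple a b c" "\<not> (b < a \<and> c < a)" "\<not> (a < b \<and> c < b)" "\<not> (a < c \<and> b < c)"
  shows "a = 3 \<and> b = 3 \<and> c = 3"
proof -
  have aux: "n = 3 \<and> l = 3" if m: "markov_triple n l l" and "n \<le> l" for n l
  proof -
    have n: "3 \<le> n" using markov_triple_ge_3[OF m] .
    have l: "0 < l" using m by (simp add: markov_triple_def)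
    have eq: "(n - 2) * l\<^sup>2 = n\<^sup>2"
      using m by (simp add: markov_triple_def power2_eq_square algebra_simps)
    also have "\<dots> \<le> 1 * l\<^sup>2"
      using n \<open>n \<le> l\<close> by (simp add: power_mono)
    finally have "n - 2 \<le> 1"
      using l by (simp only: mult_le_cancel_right) auto
    with n have "n = 3" by simp
    with eq have "l\<^sup>2 = 3\<^sup>2" by simp
    then show ?thesis using l \<open>n = 3\<close> power2_eq_iff_nonneg[of l 3] by simp
  qed
  consider "b = c" "a \<le> b" | "a = c" "b \<le> a" | "a = b" "c \<le> a"
    using assms(2-4) by linarith
  then show ?thesis
  proof cases
    case 1
    with aux[of a b] assms(1) show ?thesis by simp
  next
    case 2
    with aux[of b a] assms(1) markov_triple_swap12 show ?thesis by auto
  next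
    case 3
    then have "markov_triple c a a" using assms(1) by (simp add: markov_triple_def algebra_simps)
    with aux[of c a] 3 show ?thesis by auto
  qed
qed

section \<open>The Markov tree and its lift\<close>

text \<open>A Markov triple of integers, together with a lift to the Laurent ring. The integer triples are
  generated from \<open>(3, 3, 3)\<close> by those Vieta moves that create a strict maximum, and each move is
  lifted to a move composed with \<open>star\<close>. The inequalities make the last move readable from the integer
  triple. Starting from all translates of the initial solution by the group of \<open>\<mu>\<close> moves, written
  symmetrically, makes the relation invariant under permutations and under \<open>\<mu>\<close>.\<close>

inductive markov_tree :: "int \<Rightarrow> int \<Rightarrow> int \<Rightarrow> laurent \<Rightarrow> laurent \<Rightarrow> laurent \<Rightarrow> bool" where
  root: "p + q + r = -1 \<Longrightarrow> markov_tree 3 3 3 (s3_pow p * s1) (s3_pow q * s1) (s3_pow r * s1)"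
| step1: "markov_tree a b c f g h \<Longrightarrow> b < b * c - a \<Longrightarrow> c < b * c - a \<Longrightarrow>
    markov_tree (b * c - a) b c (g * h - star f) (star g) (star h)"
| step2: "markov_tree a b c f g h \<Longrightarrow> a < a * c - b \<Longrightarrow> c < a * c - b \<Longrightarrow>
    markov_tree a (a * c - b) c (star f) (f * h - star g) (star h)"
| step3: "markov_tree a b c f g h \<Longrightarrow> a < a * b - c \<Longrightarrow> b < a * b - c \<Longrightarrow>
    markov_tree a b (a * b - c) (star f) (star g) (f * g - star h)"

lemma markov_tree_swap12: "markov_tree a b c f g h \<Longrightarrow> markov_tree b a c g f h"
proof (induction rule: markov_tree.induct)
  case (root p q r)
  then show ?case by (intro markov_tree.root) simp
next
  case (step1 a b c f g h)
  then show ?case using markov_tree.step2[of b a c g f h] by simp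
next
  case (step2 a b c f g h)
  then show ?case using markov_tree.step1[of b a c g f h] by simp
next
  case (step3 a b c f g h)
  then show ?case using markov_tree.step3[of b a c g f h] by (simp add: mult.commute)
qed

lemma markov_tree_swap23: "markov_tree a b c f g h \<Longrightarrow> markov_tree a c b f h g"
proof (induction rule: markov_tree.induct)
  case (root p q r)
  then show ?case by (intro markov_tree.root) simp
next
  case (step1 a b c f g h)
  then show ?case using markov_tree.step1[of a c b f h g] by (simp add: mult.commute)
next
  case (step2 a b c f g h)
  then show ?case using markov_tree.step3[of a c b f h g] by simp
next
  case (step3 a b c f g h)
  then show ?case using markov_tree.step2[of a c b f h g] by simp
qed

lemma markov_tree_markov_triple: "markov_tree a b c f g h \<Longrightarrow> markov_triple a b c"
proof (induction rule: markov_tree.induct)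
  case (root p q r)
  then show ?case by (simp add: markov_triple_def)
next
  case (step1 a b c f g h)
  then show ?case using markov_triple_vieta[of b a c] by (simp add: markov_triple_swap12)
next
  case (step2 a b c f g h)
  then show ?case by (intro markov_triple_vieta)
next
  case (step3 a b c f g h)
  then show ?case using markov_triple_vieta[of a c b] by (simp add: markov_triple_swap23)
qed

lemma markov_tree_Ev: "markov_tree a b c f g h \<Longrightarrow> Ev (f, g, h) = (a, b, c)"
  by (induction rule: markov_tree.induct)
     (auto simp: Ev_def laurent_subst_mult laurent_subst_diff eval_star eval_s3_pow laurent_subst_gens)

lemma markov_tree_solution: "markov_tree a b c f g h \<Longrightarrow> star_markov_solution (f, g, h)"
proof (induction rule: markov_tree.induct)
  case (root p q r)
  have cancel: "(s3_pow k * x) * (s3_pow (- k) * y) = x * y" for k x y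
    by (simp add: s3_pow_mult_mult)
  have prod: "s3_pow p * s1 * (s3_pow q * s1) * (s3_pow r * s1) = s1 ^ 3 * s3inv"
  proof -
    have "s3_pow p * s1 * (s3_pow q * s1) * (s3_pow r * s1) = (s3_pow p * s3_pow q * s3_pow r) * s1 ^ 3"
      by (simp add: mult_ac power3_eq_cube)
    also have "s3_pow p * s3_pow q * s3_pow r = s3inv"
      using root by (simp add: s3_pow_mult s3_pow_minus_1)
    finally show ?thesis by (simp add: mult.commute)
  qed
  show ?case
    by (simp only: star_markov_solution_def prod.case prod star_mult star_s3_pow star_s1 cancel)
       (simp add: algebra_simps)
qed (simp add: star_markov_solution_def algebra_simps)+

lemma markov_tree_exists:
  assumes "markov_triple a b c"
  shows "\<exists>f g h. markov_tree a b c f g h"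
  using assms
proof (induction "nat (a + b + c)" arbitrary: a b c rule: less_induct)
  case less
  have middle: "\<exists>f g h. markov_tree x y z f g h"
    if m: "markov_triple x y z" and sum: "x + y + z = a + b + c" and max: "x < y" "z < y" for x y z
  proof -
    let ?y = "x * z - y"
    have m': "markov_triple x ?y z" using m by (rule markov_triple_vieta)
    have "\<not> (x < ?y \<and> z < ?y)" using vieta_root_cases[OF m] max by simp
    then have "?y < y" using max by linarith
    moreover have "0 < x" "0 < ?y" "0 < z" using m' by (simp_all add: markov_triple_def)
    ultimately have "nat (x + ?y + z) < nat (a + b + c)" using sum by linarith
    from less.hyps[OF this m'] obtain f g h where "markov_tree x ?y z f g h" by blast
    from markov_tree.step2[OF this] max have "markov_tree x y z (star f) (f * h - star g) (star h)" by simp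
    then show ?thesis by blast
  qed
  consider "b < a" "c < a" | "a < b" "c < b" | "a < c" "b < c" | "a = 3" "b = 3" "c = 3"
    using markov_triple_no_max[OF less.prems] by linarith
  then show ?case
  proof cases
    case 1
    with middle[of b a c] less.prems show ?thesis
      by (auto simp: markov_triple_swap12 dest: markov_tree_swap12)
  next
    case 2
    with middle[of a b c] less.prems show ?thesis by simp
  next
    case 3
    with middle[of a c b] less.prems show ?thesis
      by (auto simp: markov_triple_swap23 dest: markov_tree_swap23)
  next
    case 4
    with markov_tree.root[of "- 1" 0 0] show ?thesis by auto
  qed
qed

text \<open>A step in an outer position leaves the strict maximum at that position, so the position of the
  strict maximum identifies the last step.\<close>

lemma markov_tree_parent:
  assumes "markov_tree a b c f g h" "a < b" "c < b"
  obtains g' where "markov_tree a (a * c - b) c (star f) g' (star h)" "g = star f * star h - star g'"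
  using assms(1)
proof cases
  case step2
  then show ?thesis by (auto intro!: that)
qed (use assms in auto)

text \<open>A middle move that is not a step of the tree undoes the last step.\<close>

lemma markov_tree_vieta:
  assumes "markov_tree a b c f g h"
  shows "markov_tree a (a * c - b) c (star f) (f * h - star g) (star h)"
proof (cases "a < a * c - b \<and> c < a * c - b")
  case True
  with assms show ?thesis by (auto intro: markov_tree.step2)
next
  case False
  with vieta_root_cases[OF markov_tree_markov_triple[OF assms]] have "a < b" "c < b" by auto
  from markov_tree_parent[OF assms this] obtain g'
    where "markov_tree a (a * c - b) c (star f) g' (star h)" "g = star f * star h - star g'" .
  then show ?thesis by simp
qed

text \<open>Vieta moves normalize the group of \<open>\<mu>\<close> moves, inverting it.\<close>

lemma vieta_s3_pow:
  assumes "p + q + r = 0"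
  shows "(s3_pow p * f) * (s3_pow r * h) - star (s3_pow q * g) = s3_pow (- q) * (f * h - star g)"
proof -
  have "p + r = - q" using assms by simp
  then show ?thesis by (simp add: s3_pow_mult_mult right_diff_distrib)
qed

lemma markov_tree_s3_pow:
  assumes "markov_tree a b c f g h" "p + q + r = 0"
  shows "markov_tree a b c (s3_pow p * f) (s3_pow q * g) (s3_pow r * h)"
  using assms
proof (induction arbitrary: p q r rule: markov_tree.induct)
  case (root p' q' r')
  then show ?case
    using markov_tree.root[of "p + p'" "q + q'" "r + r'"] by (simp add: s3_pow_mult')
next
  case (step1 a b c f g h)
  then show ?case
    using markov_tree.step1[OF step1.IH[of "- p" "- q" "- r"]] vieta_s3_pow[of "- q" "- p" "- r" g h f]
    by simp
next
  case (step2 a b c f g h)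
  then show ?case
    using markov_tree.step2[OF step2.IH[of "- p" "- q" "- r"]] vieta_s3_pow[of "- p" "- q" "- r" f h g]
    by simp
next
  case (step3 a b c f g h)
  then show ?case
    using markov_tree.step3[OF step3.IH[of "- p" "- q" "- r"]] vieta_s3_pow[of "- p" "- r" "- q" f g h]
    by simp
qed

definition s3_pow_related :: "laurent \<Rightarrow> laurent \<Rightarrow> laurent \<Rightarrow> laurent \<Rightarrow> laurent \<Rightarrow> laurent \<Rightarrow> bool" where
  "s3_pow_related f g h f' g' h' \<longleftrightarrow>
     (\<exists>p q r. p + q + r = 0 \<and> f' = s3_pow p * f \<and> g' = s3_pow q * g \<and> h' = s3_pow r * h)"

lemma s3_pow_related_swap12:
  assumes "s3_pow_related f g h f' g' h'"
  shows "s3_pow_related g f h g' f' h'"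
proof -
  from assms obtain p q r where "q + p + r = 0"
    "f' = s3_pow p * f" "g' = s3_pow q * g" "h' = s3_pow r * h"
    unfolding s3_pow_related_def by (auto simp: add.commute)
  then show ?thesis unfolding s3_pow_related_def by blast
qed

lemma s3_pow_related_swap23:
  assumes "s3_pow_related f g h f' g' h'"
  shows "s3_pow_related f h g f' h' g'"
proof -
  from assms obtain p q r where "p + r + q = 0"
    "f' = s3_pow p * f" "g' = s3_pow q * g" "h' = s3_pow r * h"
    unfolding s3_pow_related_def by (auto simp: add_ac)
  then show ?thesis unfolding s3_pow_related_def by blast
qed

lemma s3_pow_related_vieta:
  assumes "s3_pow_related f g h f' g' h'"
  shows "s3_pow_related (star f) (f * h - star g) (star h) (star f') (f' * h' - star g') (star h')"
proof -
  from assms obtain p q r where pqr: "p + q + r = 0"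
    "f' = s3_pow p * f" "g' = s3_pow q * g" "h' = s3_pow r * h"
    unfolding s3_pow_related_def by blast
  then have "f' * h' - star g' = s3_pow (- q) * (f * h - star g)"
    by (simp only: vieta_s3_pow)
  moreover have "star f' = s3_pow (- p) * star f" "star h' = s3_pow (- r) * star h"
    using pqr by simp_all
  moreover have "- p + - q + - r = 0" using pqr by simp
  ultimately show ?thesis unfolding s3_pow_related_def by blast
qed

text \<open>The path from the root to an integer triple is determined by the triple, so its lifts differ only
  by the choice at the root, which the Vieta moves carry along.\<close>

lemma markov_tree_unique:
  assumes "markov_tree a b c f g h" "markov_tree a b c f' g' h'"
  shows "s3_pow_related f g h f' g' h'"
  using assms
proof (induction arbitrary: f' g' h' rule: markov_tree.induct)
  case (root p q r)
  from root.prems obtain p' q' r' where *: "p' + q' + r' = -1"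
    "f' = s3_pow p' * s1" "g' = s3_pow q' * s1" "h' = s3_pow r' * s1"
    by cases auto
  show ?case
    unfolding s3_pow_related_def
    by (rule exI[of _ "p' - p"], rule exI[of _ "q' - q"], rule exI[of _ "r' - r"])
       (use * root.hyps in \<open>simp add: s3_pow_mult'\<close>)
next
  case (step1 a b c f g h)
  from markov_tree_parent[OF markov_tree_swap12[OF step1.prems] step1.hyps(2,3)]
  obtain f0 where f0: "markov_tree b (b * c - (b * c - a)) c (star g') f0 (star h')"
    "f' = star g' * star h' - star f0" .
  have "markov_tree a b c f0 (star g') (star h')" using markov_tree_swap12[OF f0(1)] by simp
  from s3_pow_related_vieta[OF s3_pow_related_swap12[OF step1.IH[OF this]]] f0(2)
  show ?case by (auto intro: s3_pow_related_swap12)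
next
  case (step2 a b c f g h)
  from markov_tree_parent[OF step2.prems step2.hyps(2,3)]
  obtain g0 where g0: "markov_tree a (a * c - (a * c - b)) c (star f') g0 (star h')"
    "g' = star f' * star h' - star g0" .
  have "markov_tree a b c (star f') g0 (star h')" using g0(1) by simp
  from s3_pow_related_vieta[OF step2.IH[OF this]] g0(2) show ?case by simp
next
  case (step3 a b c f g h)
  from markov_tree_parent[OF markov_tree_swap23[OF step3.prems] step3.hyps(2,3)]
  obtain h0 where h0: "markov_tree a (a * b - (a * b - c)) b (star f') h0 (star g')"
    "h' = star f' * star g' - star h0" .
  have "markov_tree a b c (star f') (star g') h0" using markov_tree_swap23[OF h0(1)] by simp
  from s3_pow_related_vieta[OF s3_pow_related_swap23[OF step3.IH[OF this]]] h0(2)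
  show ?case by (auto intro: s3_pow_related_swap23)
qed

section \<open>Absence of cancellation along the tree\<close>

text \<open>In the new entry \<open>f * h - star g\<close> of a Vieta move, the lowest term in \<open>s\<^sub>3\<close> of the
  product survives; likewise after applying \<open>star\<close>. The second half makes widths add and keeps the
  statement inductive.\<close>

definition vieta_order_additive :: "laurent \<Rightarrow> laurent \<Rightarrow> laurent \<Rightarrow> bool" where
  "vieta_order_additive f g h \<longleftrightarrow>
     s3_order (f * h - star g) = s3_order f + s3_order h \<and>
     s3_order (star f * star h - g) = s3_order (star f) + s3_order (star h)"

lemma vieta_order_additive_sym: "vieta_order_additive f g h \<longleftrightarrow> vieta_order_additive h g f"
  by (simp add: vieta_order_additive_def mult.commute add.commute)

text \<open>Let \<open>?g = f * h - star g\<close>. A further move, say in the position of \<open>f\<close>, produces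
  \<open>?g * star h - f\<close>. By the hypothesis \<open>?g * star h\<close> has order
  \<open>s3_order f + s3_order h + s3_order (star h) = s3_order f - s3_width h\<close>, which is smaller than the
  order of \<open>f\<close>. So \<open>f\<close> cannot interfere with its lowest term.\<close>

lemma vieta_order_step:
  assumes "0 < s3_width f" "0 < s3_width g" "0 < s3_width h" "vieta_order_additive f g h"
  shows "0 < s3_width (f * h - star g)" (is ?width)
    and "vieta_order_additive (f * h - star g) (star f) (star h)"
    and "vieta_order_additive (f * h - star g) (star h) (star f)"
proof -
  let ?g = "f * h - star g"
  show ?width using assms by (simp add: s3_width_def vieta_order_additive_def)
  then have nz: "?g \<noteq> 0" "f \<noteq> 0" "h \<noteq> 0" using assms by (auto dest: s3_width_pos_nonzero)
  then have nz': "star f * star h - g \<noteq> 0" by (metis star_diff star_eq_0_iff star_mult star_star)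
  have *: "vieta_order_additive ?g (star u) (star v)"
    if uv: "u \<noteq> 0" "v \<noteq> 0" "0 < s3_width v"
      "s3_order ?g = s3_order u + s3_order v" "s3_order (star ?g) = s3_order (star u) + s3_order (star v)" for u v
  proof -
    have gz: "star ?g \<noteq> 0" using nz star_eq_0_iff by blast
    have "s3_order (?g * star v - star (star u)) = s3_order (?g * star v)"
      using uv nz by (intro s3_order_diff) (simp_all add: laurent_no_zero_divisors s3_order_mult s3_width_def)
    moreover have "s3_order (star ?g * star (star v) - star u) = s3_order (star ?g * star (star v))"
      using uv gz by (intro s3_order_diff) (simp_all add: laurent_no_zero_divisors s3_order_mult s3_width_def del: star_diff)
    ultimately show ?thesis
      using uv(1,2) nz(1) gz unfolding vieta_order_additive_def by (simp add: s3_order_mult del: star_diff)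
  qed
  show "vieta_order_additive ?g (star f) (star h)" "vieta_order_additive ?g (star h) (star f)"
    by (rule *; use assms nz in \<open>simp add: vieta_order_additive_def\<close>)+
qed

lemma s1_nonzero: "s1 \<noteq> 0" and s2_nonzero: "s2 \<noteq> 0"
  by (simp_all add: s1_def s2_def)

lemma s3_order_s1: "s3_order s1 = 0" and s3_order_s2: "s3_order s2 = 0"
  by (simp_all add: s3_order_def to_fls_s1 to_fls_s2)

lemma s3inv_nonzero: "s3inv \<noteq> 0"
  using s3_pow_nonzero[of "- 1"] by (simp only: s3_pow_minus_1 not_False_eq_True)

lemma s3_order_s3inv: "s3_order s3inv = - 1"
  using s3_order_s3_pow[of "- 1"] by (simp only: s3_pow_minus_1)

lemma s3_width_s1: "s3_width s1 = 1"
  by (simp add: s3_width_def star_s1 s3_order_s1 s3_order_s2 s3_order_mult s2_nonzero s3_order_s3inv s3inv_nonzero)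

text \<open>At the root the product and the entry subtracted from it have the same order, but their lowest
  coefficients differ by \<open>s\<^sub>1\<^sup>2 - s\<^sub>2\<close>, which is not zero. After applying \<open>star\<close> the product has
  strictly smaller order.\<close>

lemma vieta_order_additive_root:
  assumes "p + q + r = -1"
  shows "vieta_order_additive (s3_pow p * s1) (s3_pow q * s1) (s3_pow r * s1)"
proof -
  have star_root: "star (s3_pow k * s1) = s3_pow (- k - 1) * s2" for k
    using s3_pow_mult[of "- k" "- 1"] by (simp add: star_s1 s3_pow_minus_1 mult_ac)
  have eq1: "s3_pow p * s1 * (s3_pow r * s1) - star (s3_pow q * s1) = s3_pow (p + r) * (s1 * s1 - s2)"
  proof -
    have "- q - 1 = p + r" using assms by simp
    then show ?thesis
      by (simp only: star_root s3_pow_mult_mult right_diff_distrib)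
  qed
  have "to_fls (s1 * s1 - s2) = fls_const ([:[:0, 1:]:] * [:[:0, 1:]:] - [:0, 1:])"
    by (simp add: to_fls_s1 to_fls_s2 fls_minus_const)
  then have o1: "s1 * s1 - s2 \<noteq> 0" "s3_order (s1 * s1 - s2) = 0"
    by (auto simp: s3_order_def simp flip: to_fls_eq_0_iff)
  have eq2: "star (s3_pow p * s1) * star (s3_pow r * s1) - s3_pow q * s1
      = s3_pow (- p - r - 2) * (s2 * s2 - s3_pow 1 * s1)"
  proof -
    have "q = (- p - r - 2) + 1" using assms by simp
    then have "s3_pow q * s1 = s3_pow (- p - r - 2) * (s3_pow 1 * s1)"
      by (simp add: s3_pow_mult')
    moreover have "star (s3_pow p * s1) * star (s3_pow r * s1) = s3_pow (- p - r - 2) * (s2 * s2)"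
      by (simp only: star_root s3_pow_mult_mult) (simp add: algebra_simps)
    ultimately show ?thesis by (simp only: right_diff_distrib)
  qed
  have o2: "s3_order (s2 * s2 - s3_pow 1 * s1) = 0"
    using s3_order_diff[of "s2 * s2" "s3_pow 1 * s1"]
    by (simp add: s3_order_mult s1_nonzero s2_nonzero s3_order_s1 s3_order_s2 laurent_no_zero_divisors)
  have "s2 * s2 - s3_pow 1 * s1 \<noteq> 0"
  proof
    assume "s2 * s2 - s3_pow 1 * s1 = 0"
    then have "s3_order (s2 * s2) = s3_order (s3_pow 1 * s1)" by simp
    then show False by (simp add: s3_order_mult s1_nonzero s2_nonzero s3_order_s1 s3_order_s2)
  qed
  with o1 o2 show ?thesis
    unfolding vieta_order_additive_def eq1 eq2
    by (simp add: s3_order_s3_pow_mult s3_order_mult laurent_no_zero_divisors s1_nonzero s2_nonzero s3_order_s1 s3_order_s2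
      star_s1 s3inv_nonzero s3_order_s3inv)
qed

text \<open>Of the three moves possible after a step, the one in the same position leads back and is excluded
  by the inequalities.\<close>

lemma markov_tree_orders:
  assumes "markov_tree a b c f g h"
  shows "0 < s3_width f \<and> 0 < s3_width g \<and> 0 < s3_width h \<and>
    (b < b * c - a \<and> c < b * c - a \<longrightarrow> vieta_order_additive g f h) \<and>
    (a < a * c - b \<and> c < a * c - b \<longrightarrow> vieta_order_additive f g h) \<and>
    (a < a * b - c \<and> b < a * b - c \<longrightarrow> vieta_order_additive f h g)"
  using assms
proof (induction rule: markov_tree.induct)
  case (root p q r)
  then show ?case
    using vieta_order_additive_root[of p q r] vieta_order_additive_root[of q p r] vieta_order_additive_root[of p r q]
    by (simp add: s3_width_s3_pow_mult s3_width_s1)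
next
  case (step1 a b c f g h)
  have "\<not> (b < a \<and> c < a)"
    using vieta_root_cases[of b a c] markov_tree_markov_triple[OF step1.hyps(1)] step1.hyps
    by (simp add: markov_triple_swap12)
  then show ?case
    using vieta_order_step[of g f h] step1 by (auto simp: s3_width_star)
next
  case (step2 a b c f g h)
  have "\<not> (a < b \<and> c < b)"
    using vieta_root_cases[of a b c] markov_tree_markov_triple[OF step2.hyps(1)] step2.hyps
    by simp
  then show ?case
    using vieta_order_step[of f g h] vieta_order_additive_sym[of "star f" "star h"] step2 by (auto simp: s3_width_star)
next
  case (step3 a b c f g h)
  have "\<not> (a < c \<and> b < c)"
    using vieta_root_cases[of a c b] markov_tree_markov_triple[OF step3.hyps(1)] step3.hyps
    by (simp add: markov_triple_swap23)
  then show ?case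
    using vieta_order_step[of f h g] vieta_order_additive_sym[of "star g" "star f"] vieta_order_additive_sym[of "star f" "star g"]
      step3 by (auto simp: s3_width_star)
qed

section \<open>The orbit of the initial solution\<close>

text \<open>Up to signs and permutations, \<open>\<tau>\<^sub>1\<close> and \<open>\<tau>\<^sub>2\<close> are Vieta involutions composed with
  \<open>star\<close>. The involutions are easier to iterate.\<close>

definition vieta :: "laurent3 \<Rightarrow> laurent3" where
  "vieta = (\<lambda>(f, g, h). (star f, f * h - star g, star h))"

lemma tau1_eq: "tau1 x = lambda_tr 1 1 (sigma2 (vieta x))"
  by (simp add: tau1_def lambda_tr_def sigma2_def vieta_def split: prod.split)

lemma tau2_eq: "tau2 x = lambda_tr 0 1 (vieta (sigma1 x))"
  by (simp add: tau2_def lambda_tr_def sigma1_def vieta_def split: prod.split)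

lemma vieta_vieta: "vieta (vieta x) = x"
  by (simp add: vieta_def split: prod.split)

lemma vieta_eq: "vieta x = sigma2 (lambda_tr 1 1 (tau1 x))"
  by (simp add: tau1_def lambda_tr_def sigma2_def vieta_def split: prod.split)

lemma neg_one_power_cancel: "(- 1) ^ i * ((- 1) ^ i * f) = (f :: 'a::comm_ring_1)"
  by (simp flip: mult.assoc power_add)

lemma sigma1_sigma1: "sigma1 (sigma1 x) = x"
  and sigma2_sigma2: "sigma2 (sigma2 x) = x"
  and lambda_lambda: "lambda_tr i j (lambda_tr i j x) = x"
  and mu_mu: "mu_tr (- p) (- q) (mu_tr p q x) = x"
  by (simp_all add: sigma1_def sigma2_def lambda_tr_def mu_tr_def neg_one_power_cancel s3_pow_mult'
      split: prod.split)

text \<open>A superset of the orbit, all of whose elements lift Markov triples up to sign. The tree is already stable under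
  permutations, \<open>\<mu>\<close> moves and Vieta moves, while sign changes commute with Vieta moves and \<open>\<mu>\<close>
  moves and are permuted under conjugation by \<open>\<sigma>\<^sub>1\<close> and \<open>\<sigma>\<^sub>2\<close>.\<close>

definition signed_tree :: "laurent3 set" where
  "signed_tree = {lambda_tr i j (f, g, h) | i j f g h. \<exists>a b c. markov_tree a b c f g h}"

lemma signed_tree_lambda: "x \<in> signed_tree \<Longrightarrow> lambda_tr i j x \<in> signed_tree"
proof -
  assume "x \<in> signed_tree"
  then obtain i' j' f g h a b c where "x = lambda_tr i' j' (f, g, h)" "markov_tree a b c f g h"
    unfolding signed_tree_def by blast
  moreover have "lambda_tr i j (lambda_tr i' j' (f, g, h)) = lambda_tr (i + i') (j + j') (f, g, h)"
    by (simp add: lambda_tr_def power_add mult_ac)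
  ultimately show ?thesis unfolding signed_tree_def by blast
qed

lemma signed_tree_sigma1: "x \<in> signed_tree \<Longrightarrow> sigma1 x \<in> signed_tree"
proof -
  assume "x \<in> signed_tree"
  then obtain i j f g h a b c where "x = lambda_tr i j (f, g, h)" "markov_tree a b c f g h"
    unfolding signed_tree_def by blast
  moreover have "sigma1 (lambda_tr i j (f, g, h)) = lambda_tr (i + j) j (g, f, h)"
    by (simp add: lambda_tr_def sigma1_def power_add mult.assoc neg_one_power_cancel)
  ultimately show ?thesis unfolding signed_tree_def by (blast dest: markov_tree_swap12)
qed

lemma signed_tree_sigma2: "x \<in> signed_tree \<Longrightarrow> sigma2 x \<in> signed_tree"
proof -
  assume "x \<in> signed_tree"
  then obtain i j f g h a b c where "x = lambda_tr i j (f, g, h)" "markov_tree a b c f g h"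
    unfolding signed_tree_def by blast
  moreover have "sigma2 (lambda_tr i j (f, g, h)) = lambda_tr i (i + j) (f, h, g)"
    by (simp add: lambda_tr_def sigma2_def power_add mult.assoc neg_one_power_cancel)
  ultimately show ?thesis unfolding signed_tree_def by (blast dest: markov_tree_swap23)
qed

lemma signed_tree_vieta: "x \<in> signed_tree \<Longrightarrow> vieta x \<in> signed_tree"
proof -
  assume "x \<in> signed_tree"
  then obtain i j f g h a b c where "x = lambda_tr i j (f, g, h)" "markov_tree a b c f g h"
    unfolding signed_tree_def by blast
  moreover have "vieta (lambda_tr i j (f, g, h)) = lambda_tr i j (star f, f * h - star g, star h)"
    by (simp add: lambda_tr_def vieta_def power_add right_diff_distrib mult_ac)
  ultimately show ?thesis unfolding signed_tree_def by (blast dest: markov_tree_vieta)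
qed

lemma signed_tree_mu: "x \<in> signed_tree \<Longrightarrow> mu_tr p q x \<in> signed_tree"
proof -
  assume "x \<in> signed_tree"
  then obtain i j f g h a b c where x: "x = lambda_tr i j (f, g, h)" and m: "markov_tree a b c f g h"
    unfolding signed_tree_def by blast
  have "mu_tr p q x = lambda_tr i j (s3_pow p * f, s3_pow (- p - q) * g, s3_pow q * h)"
    by (simp add: x lambda_tr_def mu_tr_def mult_ac)
  moreover have "markov_tree a b c (s3_pow p * f) (s3_pow (- p - q) * g) (s3_pow q * h)"
    using m by (rule markov_tree_s3_pow) simp
  ultimately show ?thesis unfolding signed_tree_def by blast
qed

lemmas signed_tree_closed =
  signed_tree_lambda signed_tree_sigma1 signed_tree_sigma2 signed_tree_vieta signed_tree_mu

text \<open>The generated group contains the inverses of the generators, so invariance of the signed tree is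
  needed for these, too.\<close>

lemma generator_inverse:
  assumes "t \<in> star_markov_generators"
  obtains t' where "\<And>x. t' (t x) = x" "\<And>x. t (t' x) = x"
    "\<And>x. x \<in> signed_tree \<Longrightarrow> t x \<in> signed_tree" "\<And>x. x \<in> signed_tree \<Longrightarrow> t' x \<in> signed_tree"
proof -
  from assms consider i j where "t = lambda_tr i j" | "t = sigma1" | "t = sigma2" | "t = tau1" | "t = tau2"
    | i j where "t = mu_tr i j"
    unfolding star_markov_generators_def by blast
  then show ?thesis
  proof cases
    case 1
    then show ?thesis
      by (intro that[of t]) (simp_all add: signed_tree_closed lambda_lambda)
  next
    case 2
    then show ?thesis
      by (intro that[of t]) (simp_all add: signed_tree_closed sigma1_sigma1)
  next
    case 3
    then show ?thesis
      by (intro that[of t]) (simp_all add: signed_tree_closed sigma2_sigma2)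
  next
    case 4
    then show ?thesis
      by (intro that[of "\<lambda>x. vieta (sigma2 (lambda_tr 1 1 x))"])
        (simp_all add: tau1_eq signed_tree_closed lambda_lambda sigma2_sigma2 vieta_vieta del: One_nat_def)
  next
    case 5
    then show ?thesis
      by (intro that[of "\<lambda>x. sigma1 (vieta (lambda_tr 0 1 x))"])
        (simp_all add: tau2_eq signed_tree_closed lambda_lambda sigma1_sigma1 vieta_vieta del: One_nat_def)
  next
    case (6 i j)
    then show ?thesis
      using mu_mu[of "- i" "- j"]
      by (intro that[of "mu_tr (- i) (- j)"]) (simp_all add: signed_tree_closed mu_mu)
  qed
qed

lemma generator_Bij: "t \<in> star_markov_generators \<Longrightarrow> t \<in> Bij UNIV"
proof (elim generator_inverse)
  fix t' assume "\<And>x. t' (t x) = x" "\<And>x. t (t' x) = x"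
  then have "bij t" by (metis bijI')
  then show "t \<in> Bij UNIV" by (simp add: Bij_def)
qed

lemma star_markov_group_Bij: "g \<in> star_markov_group \<Longrightarrow> g \<in> Bij UNIV"
  using group.generate_in_carrier[OF group_BijGroup[of UNIV], of star_markov_generators g] generator_Bij
  by (auto simp: star_markov_group_def BijGroup_def)

lemma mult_BijGroup: "g \<in> Bij UNIV \<Longrightarrow> h \<in> Bij UNIV \<Longrightarrow> (g \<otimes>\<^bsub>BijGroup UNIV\<^esub> h) x = g (h x)"
  by (simp add: BijGroup_def compose_def)

lemma star_markov_group_signed_tree:
  assumes "g \<in> star_markov_group" "x \<in> signed_tree"
  shows "g x \<in> signed_tree"
  using assms unfolding star_markov_group_def
proof (induction arbitrary: x rule: generate.induct)
  case one
  then show ?case by (simp add: BijGroup_def)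
next
  case (incl t)
  from generator_inverse[OF incl.hyps] incl.prems show ?case by metis
next
  case (inv t)
  from generator_inverse[OF inv.hyps] obtain t' where t': "\<And>x. t' (t x) = x" "\<And>x. t (t' x) = x"
    "\<And>x. x \<in> signed_tree \<Longrightarrow> t' x \<in> signed_tree"
    by metis
  have "inj t" by (metis injI t'(1))
  then have "inv_into UNIV t x = t' x" by (metis inv_f_f t'(2))
  then show ?case
    using inv t'(3) generator_Bij by (simp add: inv_BijGroup)
next
  case (eng g1 g2)
  then have "g1 \<in> Bij UNIV" "g2 \<in> Bij UNIV"
    using star_markov_group_Bij by (simp_all add: star_markov_group_def)
  with eng show ?case by (simp add: mult_BijGroup)
qed

lemma initial_solution_signed_tree: "initial_solution \<in> signed_tree"
proof -
  have "initial_solution = lambda_tr 0 0 (s3_pow 0 * s1, s3_pow (- 1) * s1, s3_pow 0 * s1)"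
    by (simp add: initial_solution_def lambda_tr_def s3_pow_minus_1 mult.commute)
  moreover have "markov_tree 3 3 3 (s3_pow 0 * s1) (s3_pow (- 1) * s1) (s3_pow 0 * s1)"
    by (rule markov_tree.root) simp
  ultimately show ?thesis unfolding signed_tree_def by blast
qed

lemma star_markov_orbit_signed_tree: "star_markov_orbit \<subseteq> signed_tree"
  using star_markov_group_signed_tree initial_solution_signed_tree
  unfolding star_markov_orbit_def by blast

lemma star_markov_orbit_generator:
  assumes "t \<in> star_markov_generators" "x \<in> star_markov_orbit"
  shows "t x \<in> star_markov_orbit"
proof -
  from assms(2) obtain g where g: "g \<in> star_markov_group" "x = g initial_solution"
    unfolding star_markov_orbit_def by blast
  have t: "t \<in> star_markov_group"
    unfolding star_markov_group_def using assms(1) by (rule generate.incl)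
  have "t x = (t \<otimes>\<^bsub>BijGroup UNIV\<^esub> g) initial_solution"
    using g t star_markov_group_Bij by (simp add: mult_BijGroup)
  moreover have "t \<otimes>\<^bsub>BijGroup UNIV\<^esub> g \<in> star_markov_group"
    using t g(1) unfolding star_markov_group_def by (rule generate.eng)
  ultimately show ?thesis unfolding star_markov_orbit_def by blast
qed

lemma star_markov_orbit_closed:
  assumes "x \<in> star_markov_orbit"
  shows star_markov_orbit_sigma1: "sigma1 x \<in> star_markov_orbit"
    and star_markov_orbit_sigma2: "sigma2 x \<in> star_markov_orbit"
    and star_markov_orbit_mu: "mu_tr p q x \<in> star_markov_orbit"
    and star_markov_orbit_vieta: "vieta x \<in> star_markov_orbit"
proof -
  have "sigma1 \<in> star_markov_generators" "sigma2 \<in> star_markov_generators"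
    "tau1 \<in> star_markov_generators" "\<And>p q. mu_tr p q \<in> star_markov_generators"
    "\<And>i j. lambda_tr i j \<in> star_markov_generators"
    unfolding star_markov_generators_def by blast+
  then show "sigma1 x \<in> star_markov_orbit" "sigma2 x \<in> star_markov_orbit"
    "mu_tr p q x \<in> star_markov_orbit" "vieta x \<in> star_markov_orbit"
    using assms unfolding vieta_eq by (simp_all add: star_markov_orbit_generator)
qed

lemma markov_tree_orbit: "markov_tree a b c f g h \<Longrightarrow> (f, g, h) \<in> star_markov_orbit"
proof (induction rule: markov_tree.induct)
  case (root p q r)
  have "\<one>\<^bsub>BijGroup UNIV\<^esub> \<in> star_markov_group"
    unfolding star_markov_group_def by (rule generate.one)
  moreover have "initial_solution = \<one>\<^bsub>BijGroup UNIV\<^esub> initial_solution"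
    by (simp add: BijGroup_def)
  ultimately have "initial_solution \<in> star_markov_orbit"
    unfolding star_markov_orbit_def by blast
  then have "mu_tr p r initial_solution \<in> star_markov_orbit"
    by (rule star_markov_orbit_mu)
  also have "mu_tr p r initial_solution = (s3_pow p * s1, s3_pow q * s1, s3_pow r * s1)"
  proof -
    have "q = (- p - r) + (- 1)" using root by simp
    then have "s3_pow q = s3_pow (- p - r) * s3inv" by (simp only: s3_pow_minus_1 flip: s3_pow_mult)
    then show ?thesis by (simp add: mu_tr_def initial_solution_def mult_ac)
  qed
  finally show ?case .
next
  case (step1 a b c f g h)
  from step1.IH have "sigma1 (vieta (sigma1 (f, g, h))) \<in> star_markov_orbit"
    by (intro star_markov_orbit_closed)
  then show ?case by (simp add: sigma1_def vieta_def)
next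
  case (step2 a b c f g h)
  from step2.IH have "vieta (f, g, h) \<in> star_markov_orbit"
    by (rule star_markov_orbit_vieta)
  then show ?case by (simp add: vieta_def)
next
  case (step3 a b c f g h)
  from step3.IH have "sigma2 (vieta (sigma2 (f, g, h))) \<in> star_markov_orbit"
    by (intro star_markov_orbit_closed)
  then show ?case by (simp add: sigma2_def vieta_def)
qed

text \<open>All entries in the tree evaluate to positive integers, so a positive value rules out sign changes.\<close>

lemma star_markov_orbit_positive:
  assumes "x \<in> star_markov_orbit" "Ev x = (a, b, c)" "0 < a" "0 < b" "0 < c"
  obtains f g h where "x = (f, g, h)" "markov_tree a b c f g h"
proof -
  from assms(1) star_markov_orbit_signed_tree obtain i j f g h a' b' c'
    where x: "x = lambda_tr i j (f, g, h)" and m: "markov_tree a' b' c' f g h"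
    unfolding signed_tree_def by blast
  have sign: "laurent_subst 3 3 1 1 ((- 1) ^ n * u) = (- 1) ^ n * (laurent_subst 3 3 1 1 u :: int)" for n u
    by (simp add: laurent_subst_mult laurent_subst_power laurent_subst_uminus)
  have abc: "a = (- 1) ^ i * a'" "b = (- 1) ^ (i + j) * b'" "c = (- 1) ^ j * c'"
    using assms(2) markov_tree_Ev[OF m] by (simp_all add: x lambda_tr_def Ev_def sign)
  moreover have "0 < a'" "0 < c'"
    using markov_tree_markov_triple[OF m] by (simp_all add: markov_triple_def)
  ultimately have "even i" "even j"
    using assms(3,5) by (auto intro: ccontr)
  with x m abc show ?thesis by (intro that[of f g h]) (simp_all add: lambda_tr_def)
qed

theorem theorem1p1:
  fixes a b c :: int
  assumes "markov_triple a b c"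
    and "0 < a" and "a < b" and "0 < c" and "c < b" and "6 \<le> b"
  shows "\<exists>!x. x \<in> star_markov_orbit \<and> reduced_polynomial_solution x \<and> Ev x = (a, b, c)"
proof (rule ex_ex1I)
  from markov_tree_exists[OF markov_triple_vieta[OF assms(1)]] obtain f g h
    where parent: "markov_tree a (a * c - b) c f g h" by blast
  have parent_orders: "0 < s3_width f" "0 < s3_width g" "0 < s3_width h" "vieta_order_additive f g h"
    using markov_tree_orders[OF parent] assms(3,5) by simp_all
  \<comment> \<open>Multiplying \<open>star f\<close> by a power of \<open>s\<^sub>3\<close> divides \<open>f\<close> by that power. A \<open>\<mu>\<close> move divides the
    middle entry by both powers, and this is the right normalization because its order is the sum.\<close>
  define p q where "p = s3_order f" and "q = s3_order h"
  let ?g = "f * h - star g"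
  have width: "0 < s3_width ?g" and order: "s3_order ?g = p + q"
    using vieta_order_step(1)[OF parent_orders] parent_orders(4)
    by (simp_all add: vieta_order_additive_def p_def q_def)
  let ?x = "(s3_pow p * star f, s3_pow (- p - q) * ?g, s3_pow q * star h)"
  have tree: "markov_tree a b c (s3_pow p * star f) (s3_pow (- p - q) * ?g) (s3_pow q * star h)"
    using markov_tree_s3_pow[OF markov_tree_vieta[OF parent], of p "- p - q" q] by simp
  have "?x = (star (s3_pow (- p) * f), s3_pow (- p - q) * ?g, star (s3_pow (- q) * h))"
    by simp
  moreover have "reduced_polynomial (s3_pow (- p) * f)" "reduced_polynomial (s3_pow (- q) * h)"
    using parent_orders by (simp_all add: p_def q_def reduced_polynomial_normalized)
  moreover have "reduced_polynomial (s3_pow (- p - q) * ?g)"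
    using reduced_polynomial_normalized[OF width] by (simp add: order)
  ultimately have "reduced_polynomial_solution ?x"
    using markov_tree_solution[OF tree] unfolding reduced_polynomial_solution_def by blast
  then show "\<exists>x. x \<in> star_markov_orbit \<and> reduced_polynomial_solution x \<and> Ev x = (a, b, c)"
    using markov_tree_orbit[OF tree] markov_tree_Ev[OF tree] by blast
next
  fix x y
  assume x: "x \<in> star_markov_orbit \<and> reduced_polynomial_solution x \<and> Ev x = (a, b, c)"
    and y: "y \<in> star_markov_orbit \<and> reduced_polynomial_solution y \<and> Ev y = (a, b, c)"
  have pos: "0 < a" "0 < b" "0 < c" using assms by simp_all
  from x pos obtain f g h where f: "x = (f, g, h)" "markov_tree a b c f g h"
    by (blast elim: star_markov_orbit_positive)
  from y pos obtain f' g' h' where f': "y = (f', g', h')" "markov_tree a b c f' g' h'"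
    by (blast elim: star_markov_orbit_positive)
  from markov_tree_unique[OF f(2) f'(2)] obtain p q r where pqr: "p + q + r = 0"
    "f' = s3_pow p * f" "g' = s3_pow q * g" "h' = s3_pow r * h"
    unfolding s3_pow_related_def by blast
  have red: "reduced_polynomial (star u)" if "reduced_polynomial_solution (u, v, w)" for u v w
    using that by (auto simp: reduced_polynomial_solution_def)
  have red': "reduced_polynomial (star w)" if "reduced_polynomial_solution (u, v, w)" for u v w
    using that by (auto simp: reduced_polynomial_solution_def)
  have "- p = 0"
    using x y red[of f g h] red[of f' g' h']
    by (intro reduced_polynomial_s3_pow_mult[of "star f"]) (simp_all add: f f' pqr)
  moreover have "- r = 0"
    using x y red'[of f g h] red'[of f' g' h']
    by (intro reduced_polynomial_s3_pow_mult[of "star h"]) (simp_all add: f f' pqr)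
  ultimately show "x = y" using pqr by (simp add: f f')
qed

end
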